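(* Let $\mathbb{F}$ be a field of characteristic zero, let $A$ and $\tilde A$ be Gorenstein algebras over $\mathbb{F}$ of finite vector space dimension greater than $1$, with maximal ideals $\mathfrak{m}$ and $\tilde{\mathfrak{m}}$, and let $\pi$, $\tilde\pi$ be admissible projections on $\mathfrak{m}$, $\tilde{\mathfrak{m}}$, respectively. Then $A$ and $\tilde A$ are isomorphic (as $\mathbb{F}$-algebras) if and only if the hypersurfaces $S_{\pi}\subset\mathfrak{m}$ and $S_{\tilde\pi}\subset\tilde{\mathfrak{m}}$ are affinely equivalent. Moreover, if $\mathcal{A}:\mathfrak{m}\to\tilde{\mathfrak{m}}$ is a bijective affine map such that $\mathcal{A}(S_{\pi})=S_{\tilde\pi}$, then the linear part of $\mathcal{A}$ is an algebra isomorphism between $\mathfrak{m}$ and $\tilde{\mathfrak{m}}$.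
   Context: Let $\mathbb{F}$ be a field of characteristic zero. A Gorenstein algebra of finite vector space dimension greater than $1$ over $\mathbb{F}$ is a local commutative associative unital $\mathbb{F}$-algebra $A$ with $1<\dim_{\mathbb{F}}A<\infty$ whose maximal ideal $\mathfrak{m}$ has 1-dimensional annihilator $\mathrm{Ann}(\mathfrak{m}):=\{u\in\mathfrak{m}: u\cdot\mathfrak{m}=0\}$ (dimension over $\mathbb{F}$). Let $\mathbf{1}$ be the unit of $A$. The ideal $\mathfrak{m}$ is nilpotent. An admissible projection on $\mathfrak{m}$ is an $\mathbb{F}$-linear projection $\pi:\mathfrak{m}\to\mathfrak{m}$ ($\pi^2=\pi$) with range $\mathrm{Ann}(\mathfrak{m})$. Define the affine quadric $Q'_{\pi}:=\{u\in\mathfrak{m}:\pi(2u+u^2)=0\}$ and the map $\log(\mathbf{1}+u):=\sum_{m=1}^{\infty}\frac{(-1)^{m+1}}{m}u^m\in\mathfrak{m}$ for $u\in\mathfrak{m}$ (a finite sum). The hypersurface associated to $\pi$ is $$S_{\pi}:=\{\log(\mathbf{1}+u): u\in Q'_{\pi}\}\subset\mathfrak{m}.$$ The same definitions apply to $\tilde A$, $\tilde{\mathfrak{m}}$, $\tilde\pi$. $S_{\pi}$ and $S_{\tilde\pi}$ are called affinely equivalent if there exists a bijective affine map $\mathcal{A}:\mathfrak{m}\to\tilde{\mathfrak{m}}$ (over $\mathbb{F}$) such that $\mathcal{A}(S_{\pi})=S_{\tilde\pi}$. The linear part of an affine map $\mathcal{A}$ is $u\mapsto\mathcal{A}(u)-\mathcal{A}(0)$.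 *)

theory Defs
  imports Complex_Main
begin

definition ring_ideal :: "'a::comm_ring_1 set \<Rightarrow> bool" where
  "ring_ideal I \<longleftrightarrow> 0 \<in> I \<and> (\<forall>x\<in>I. \<forall>y\<in>I. x + y \<in> I) \<and> (\<forall>a. \<forall>x\<in>I. a * x \<in> I)"

definition maximal_ideal :: "'a::comm_ring_1 set \<Rightarrow> bool" where
  "maximal_ideal M \<longleftrightarrow>
     ring_ideal M \<and> M \<noteq> UNIV \<and> (\<forall>I. ring_ideal I \<longrightarrow> M \<subseteq> I \<longrightarrow> I = M \<or> I = UNIV)"

definition Ann :: "'a::comm_ring_1 set \<Rightarrow> 'a set" where
  "Ann \<mm> = {u \<in> \<mm>. \<forall>v\<in>\<mm>. u * v = 0}"

text \<open>The algebra is the whole type \<open>'a\<close>, with scalar multiplication \<open>scale\<close>; \<open>\<mm>\<close> is its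
  only maximal ideal. Since \<open>dim\<close> is \<open>0\<close> for infinite-dimensional spaces, \<open>finite_dim\<close> is implied by
  \<open>dim_gt_1\<close>; it is stated for clarity. The residue field is not assumed to be \<open>'f\<close>.\<close>

locale gorenstein_algebra = vector_space scale
  for scale :: "'f::field_char_0 \<Rightarrow> 'a::comm_ring_1 \<Rightarrow> 'a" and \<mm> :: "'a set" +
  assumes scale_mult_left: "scale c (x * y) = scale c x * y"
    and local_ring: "maximal_ideal M \<longleftrightarrow> M = \<mm>"
    and finite_dim: "\<exists>B. finite B \<and> span B = UNIV"
    and dim_gt_1: "1 < dim (UNIV :: 'a set)"
    and dim_Ann: "dim (Ann \<mm>) = 1"

text \<open>Maps defined on a subspace are total functions that are only constrained, and only
  ever evaluated, on that subspace.\<close>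

definition linear_between ::
  "('f \<Rightarrow> 'a \<Rightarrow> 'a) \<Rightarrow> 'a set \<Rightarrow> ('f \<Rightarrow> 'b \<Rightarrow> 'b) \<Rightarrow> 'b set \<Rightarrow> ('a::ab_group_add \<Rightarrow> 'b::ab_group_add) \<Rightarrow> bool"
  where
  "linear_between s V s' W f \<longleftrightarrow>
     f ` V \<subseteq> W \<and> (\<forall>x\<in>V. \<forall>y\<in>V. f (x + y) = f x + f y) \<and> (\<forall>c. \<forall>x\<in>V. f (s c x) = s' c (f x))"

definition affine_between ::
  "('f \<Rightarrow> 'a \<Rightarrow> 'a) \<Rightarrow> 'a set \<Rightarrow> ('f \<Rightarrow> 'b \<Rightarrow> 'b) \<Rightarrow> 'b set \<Rightarrow> ('a::ab_group_add \<Rightarrow> 'b::ab_group_add) \<Rightarrow> bool"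
  where
  "affine_between s V s' W f \<longleftrightarrow>
     (\<exists>L c. linear_between s V s' W L \<and> c \<in> W \<and> (\<forall>x\<in>V. f x = L x + c))"

definition linear_part :: "('a::zero \<Rightarrow> 'b::minus) \<Rightarrow> 'a \<Rightarrow> 'b" where
  "linear_part f = (\<lambda>u. f u - f 0)"

definition admissible_projection ::
  "('f \<Rightarrow> 'a \<Rightarrow> 'a) \<Rightarrow> 'a set \<Rightarrow> ('a::comm_ring_1 \<Rightarrow> 'a) \<Rightarrow> bool" where
  "admissible_projection scale \<mm> \<pi> \<longleftrightarrow>
     linear_between scale \<mm> scale \<mm> \<pi> \<and> (\<forall>u\<in>\<mm>. \<pi> (\<pi> u) = \<pi> u) \<and> \<pi> ` \<mm> = Ann \<mm>"

definition quadric :: "'a::comm_ring_1 set \<Rightarrow> ('a \<Rightarrow> 'a) \<Rightarrow> 'a set" where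
  "quadric \<mm> \<pi> = {u \<in> \<mm>. \<pi> (2 * u + u\<^sup>2) = 0}"

text \<open>\<open>alg_log1 scale u\<close> is \<open>log (1 + u)\<close>: the vanishing terms of the series are left out, so that
  for nilpotent \<open>u\<close> (in particular on the maximal ideal) the index set is finite.\<close>

definition alg_log1 :: "('f::field_char_0 \<Rightarrow> 'a \<Rightarrow> 'a) \<Rightarrow> 'a::comm_ring_1 \<Rightarrow> 'a" where
  "alg_log1 scale u = (\<Sum>m | 1 \<le> m \<and> u ^ m \<noteq> 0. scale ((-1) ^ (m + 1) / of_nat m) (u ^ m))"

definition hypersurface ::
  "('f::field_char_0 \<Rightarrow> 'a \<Rightarrow> 'a) \<Rightarrow> 'a::comm_ring_1 set \<Rightarrow> ('a \<Rightarrow> 'a) \<Rightarrow> 'a set" where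
  "hypersurface scale \<mm> \<pi> = alg_log1 scale ` quadric \<mm> \<pi>"

definition affinely_equivalent ::
  "('f \<Rightarrow> 'a \<Rightarrow> 'a) \<Rightarrow> 'a::ab_group_add set \<Rightarrow> 'a set \<Rightarrow>
   ('f \<Rightarrow> 'b \<Rightarrow> 'b) \<Rightarrow> 'b::ab_group_add set \<Rightarrow> 'b set \<Rightarrow> bool" where
  "affinely_equivalent s V S s' W S' \<longleftrightarrow>
     (\<exists>\<A>. affine_between s V s' W \<A> \<and> bij_betw \<A> V W \<and> \<A> ` S = S')"

definition algebras_isomorphic ::
  "('f::field \<Rightarrow> 'a::comm_ring_1 \<Rightarrow> 'a) \<Rightarrow> ('f \<Rightarrow> 'b::comm_ring_1 \<Rightarrow> 'b) \<Rightarrow> bool"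
  where
  "algebras_isomorphic s s' \<longleftrightarrow>
     (\<exists>\<phi>. Vector_Spaces.linear s s' \<phi> \<and> bij \<phi> \<and> (\<forall>x y. \<phi> (x * y) = \<phi> x * \<phi> y) \<and> \<phi> 1 = 1)"

text \<open>Maximal ideals are algebras without unit, so no condition on units appears here.\<close>

definition nonunital_algebra_iso ::
  "('f \<Rightarrow> 'a \<Rightarrow> 'a) \<Rightarrow> 'a set \<Rightarrow> ('f \<Rightarrow> 'b \<Rightarrow> 'b) \<Rightarrow> 'b set \<Rightarrow> ('a::comm_ring_1 \<Rightarrow> 'b::comm_ring_1) \<Rightarrow> bool"
  where
  "nonunital_algebra_iso s V s' W f \<longleftrightarrow>
     linear_between s V s' W f \<and> bij_betw f V W \<and> (\<forall>x\<in>V. \<forall>y\<in>V. f (x * y) = f x * f y)"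

end

theory Submission
  imports Defs "HOL-Computational_Algebra.Formal_Power_Series" "HOL-Computational_Algebra.Polynomial"
begin

text \<open>
  Write \<open>\<pi> u = \<omega> u \<cdot> a\<close> with \<open>Ann \<mm>\<close> spanned by \<open>a\<close>. Since \<open>1 + (2u + u\<^sup>2) = (1 + u)\<^sup>2\<close>, the
  hypersurface is the zero set of \<open>P y = \<omega> (exp (2y) - 1)\<close>, and \<open>P (y + t a) = P y + 2 t\<close>.

  If \<open>y \<mapsto> L y + c\<close> maps the zero set of \<open>P\<close> to that of \<open>P'\<close>, then no two points of the former differ by
  \<open>L\<^sup>-\<^sup>1 a'\<close>, which forces \<open>L a\<close> to be a multiple \<open>k a'\<close>. Moving along the lines in direction \<open>a\<close> then
  gives \<open>P' (L y + c) = k P y\<close>. With \<open>f z = \<omega>' (exp (2c) z)\<close> this reads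
  \<open>f (exp (2 L y) - 1) = k \<omega> (exp (2y) - 1)\<close>. Its homogeneous parts of degree 1, 2 and 3, polarised, say
  that \<open>f\<close> is zero on \<open>z = L x L y - L (x y)\<close> and on \<open>z \<mm>'\<close>, so \<open>z = 0\<close> by nondegeneracy.

  Conversely, an isomorphism carries \<open>\<omega>'\<close> to a functional of the form \<open>z \<mapsto> k \<omega> (exp (2b) z)\<close>, again by
  nondegeneracy, and up to a multiple of \<open>a\<close> the factor \<open>exp (2b)\<close> amounts to translating by \<open>b\<close>.
\<close>

unbundle fps_syntax

section \<open>Linear maps and forms on a subspace\<close>

lemma linear_between_add: "linear_between s V s' W f \<Longrightarrow> x \<in> V \<Longrightarrow> y \<in> V \<Longrightarrow> f (x + y) = f x + f y"
  and linear_between_scale: "linear_between s V s' W f \<Longrightarrow> x \<in> V \<Longrightarrow> f (s c x) = s' c (f x)"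
  and linear_between_in: "linear_between s V s' W f \<Longrightarrow> x \<in> V \<Longrightarrow> f x \<in> W"
  by (auto simp: linear_between_def)

lemma linear_between_zero:
  assumes "linear_between s V s' W f" "0 \<in> V" shows "f 0 = 0"
  using linear_between_add[OF assms(1) assms(2) assms(2)] by simp

lemma linear_between_diff:
  assumes "linear_between s V s' W f" "x - y \<in> V" "y \<in> V" shows "f (x - y) = f x - f y"
  using linear_between_add[OF assms] by (simp add: algebra_simps)

lemma linear_between_sum:
  assumes f: "linear_between s V s' W f" and V: "0 \<in> V" "\<And>x y. x \<in> V \<Longrightarrow> y \<in> V \<Longrightarrow> x + y \<in> V"
    and g: "\<And>i. i \<in> I \<Longrightarrow> g i \<in> V"
  shows "f (sum g I) = (\<Sum>i\<in>I. f (g i))"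
proof -
  have "sum g I \<in> V \<and> f (sum g I) = (\<Sum>i\<in>I. f (g i))"
    using g
  proof (induction I rule: infinite_finite_induct)
    case (insert i I)
    then show ?case using linear_between_add[OF f] V by auto
  qed (use V linear_between_zero[OF f] in auto)
  then show ?thesis ..
qed

text \<open>Induction on \<open>E\<close> for all \<open>V\<close> and \<open>g\<close>: on the
  kernel \<open>K\<close> of the new form, \<open>g\<close> is a combination of the old ones. The
  difference \<open>h\<close> vanishes on \<open>K\<close>, hence is a multiple of
  \<open>B e\<close>.\<close>

lemma linear_form_eq_sum:
  fixes s :: "'f::field \<Rightarrow> 'a::ab_group_add \<Rightarrow> 'a" and B :: "'e \<Rightarrow> 'a \<Rightarrow> 'f"
  assumes "finite E" and "module.subspace s V" and "vector_space s"
    and "\<And>e. e \<in> E \<Longrightarrow> linear_between s V (*) UNIV (B e)"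
    and "linear_between s V (*) UNIV g"
    and "\<And>z. z \<in> V \<Longrightarrow> (\<And>e. e \<in> E \<Longrightarrow> B e z = 0) \<Longrightarrow> g z = 0"
  shows "\<exists>c. \<forall>z\<in>V. g z = (\<Sum>e\<in>E. c e * B e z)"
  using assms
proof (induction E arbitrary: V g rule: finite_induct)
  case empty
  then show ?case by simp
next
  case (insert e E)
  interpret vector_space s by (rule insert.prems(2))
  note [simp] = \<open>subspace V\<close>[THEN subspace_add] \<open>subspace V\<close>[THEN subspace_scale]
    \<open>subspace V\<close>[THEN subspace_0] \<open>subspace V\<close>[THEN subspace_diff]
  note Be = insert.prems(3)[OF insertI1]
  define K where "K = {z \<in> V. B e z = 0}"
  have K_sub: "subspace K"
    unfolding K_def using Be
    by (intro subspaceI) (auto simp: linear_between_add linear_between_scale linear_between_zero)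
  have K: "linear_between s K (*) UNIV f" if "linear_between s V (*) UNIV f" for f
    using that by (auto simp: linear_between_def K_def)
  have "\<exists>c. \<forall>z\<in>K. g z = (\<Sum>i\<in>E. c i * B i z)"
  proof (rule insert.IH)
    fix z assume "z \<in> K" "\<And>i. i \<in> E \<Longrightarrow> B i z = 0"
    then show "g z = 0" using insert.prems(5)[of z] by (auto simp: K_def)
  qed (use K_sub insert.prems(2) K[OF insert.prems(3)] K[OF insert.prems(4)] in blast)+
  then obtain c where c: "\<And>z. z \<in> K \<Longrightarrow> g z = (\<Sum>i\<in>E. c i * B i z)"
    by blast
  define h where "h z = g z - (\<Sum>i\<in>E. c i * B i z)" for z
  have h: "linear_between s V (*) UNIV h"
    using insert.prems(3,4) unfolding h_def linear_between_def
    by (auto simp: algebra_simps sum_distrib_left simp flip: sum.distrib intro!: sum.cong)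
  have "\<exists>d. \<forall>z\<in>V. h z = d * B e z"
  proof (cases "\<exists>v\<in>V. B e v \<noteq> 0")
    case True
    then obtain v where v: "v \<in> V" "B e v \<noteq> 0" by blast
    have "h z = h v / B e v * B e z" if z: "z \<in> V" for z
    proof -
      let ?w = "z - s (B e z / B e v) v"
      have "B e ?w = 0"
        using v z by (simp add: linear_between_diff[OF Be] linear_between_scale[OF Be])
      then have "?w \<in> K" using v z by (simp add: K_def)
      then have "h ?w = 0" by (simp add: h_def c)
      then show ?thesis
        using v z by (simp add: linear_between_diff[OF h] linear_between_scale[OF h])
    qed
    then show ?thesis by blast
  next
    case False
    then have "z \<in> V \<Longrightarrow> h z = 0" for z by (auto simp: K_def h_def c)
    then show ?thesis by (intro exI[of _ 0]) auto
  qed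
  then obtain d where d: "\<And>z. z \<in> V \<Longrightarrow> h z = d * B e z" by blast
  have "g z = (\<Sum>i\<in>insert e E. (c(e := d)) i * B i z)" if "z \<in> V" for z
  proof -
    have "(\<Sum>i\<in>E. (c(e := d)) i * B i z) = (\<Sum>i\<in>E. c i * B i z)"
      using insert.hyps by (intro sum.cong) auto
    then show ?thesis using d[OF that] insert.hyps by (simp add: h_def algebra_simps)
  qed
  then show ?case by blast
qed

section \<open>Power series in nilpotent elements\<close>

lemma sum_Cauchy_product:
  fixes f g :: "nat \<Rightarrow> 'a::comm_ring_1"
  assumes f: "\<And>n. N \<le> n \<Longrightarrow> f n = 0" and g: "\<And>n. M \<le> n \<Longrightarrow> g n = 0"
  shows "(\<Sum>n<N + M. \<Sum>i\<le>n. f i * g (n - i)) = (\<Sum>n<N. f n) * (\<Sum>n<M. g n)"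
proof -
  have "(\<Sum>n<N + M. \<Sum>i\<le>n. f i * g (n - i)) = (\<Sum>(i,j)\<in>{(i,j). i + j < N + M}. f i * g j)"
    by (rule sum.triangle_reindex[symmetric])
  \<comment> \<open>The triangle contains the rectangle, and outside the rectangle one of the
    factors vanishes.\<close>
  also have "\<dots> = (\<Sum>(i,j)\<in>{..<N} \<times> {..<M}. f i * g j)"
  proof (rule sum.mono_neutral_right)
    show "finite {(i,j). i + j < N + M}"
      by (rule finite_subset[of _ "{..N + M} \<times> {..N + M}"]) auto
    have "f i * g j = 0" if "\<not> (i < N \<and> j < M)" for i j
      using f[of i] g[of j] that by (cases "i < N") (auto simp: not_less)
    then show "\<forall>p\<in>{(i, j). i + j < N + M} - {..<N} \<times> {..<M}. (case p of (i, j) \<Rightarrow> f i * g j) = 0"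
      by fastforce
  qed auto
  finally show ?thesis
    by (simp add: sum_product sum.cartesian_product)
qed

lemma power_eq_0_mono:
  fixes u :: "'a::comm_ring_1"
  assumes "u ^ N = 0" "N \<le> n" shows "u ^ n = 0"
  using assms le_imp_power_dvd[of N n u] by simp

text \<open>Summing over the nonzero powers avoids fixing a nilpotency index. If \<open>u\<close> is
  not nilpotent, the index set is infinite and the sum is 0.\<close>

definition nil_eval :: "('f \<Rightarrow> 'a \<Rightarrow> 'a) \<Rightarrow> 'f::field_char_0 fps \<Rightarrow> 'a \<Rightarrow> 'a::comm_ring_1" where
  "nil_eval s f u = (\<Sum>n | u ^ n \<noteq> 0. s (f $ n) (u ^ n))"

locale commutative_algebra = vector_space scale
  for scale :: "'f::field_char_0 \<Rightarrow> 'a::comm_ring_1 \<Rightarrow> 'a" +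
  assumes scale_mult: "scale c (x * y) = scale c x * y"
begin

lemma mult_scale: "x * scale c y = scale c (x * y)"
  using scale_mult[of c y x] by (simp add: mult.commute)

lemma scale_conv: "scale c x = scale c 1 * x"
  using scale_mult[of c 1 x] by simp

lemma scale_of_nat: "scale (of_nat n) x = of_nat n * x"
  by (induction n) (auto simp: algebra_simps scale_left_distrib)

lemma scale_2: "scale 2 x = 2 * x"
  using scale_of_nat[of 2 x] by simp

abbreviation ev :: "'f fps \<Rightarrow> 'a \<Rightarrow> 'a" where "ev \<equiv> nil_eval scale"

lemma ev_eq:
  assumes "u ^ N = 0"
  shows "ev f u = (\<Sum>n<N. scale (f $ n) (u ^ n))"
proof -
  have "{n. u ^ n \<noteq> 0} \<subseteq> {..<N}"
    using power_eq_0_mono[OF assms] by (auto simp: not_less[symmetric])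
  then show ?thesis
    unfolding nil_eval_def by (intro sum.mono_neutral_left) auto
qed

text \<open>Each binomial term has exponent at least \<open>N\<close> in \<open>x\<close> or at
  least \<open>M\<close> in \<open>y\<close>.\<close>

lemma nilpotent_add_index:
  fixes x y :: 'a
  assumes "x ^ N = 0" "y ^ M = 0" shows "(x + y) ^ (N + M) = 0"
proof -
  have "of_nat (N + M choose k) * x ^ k * y ^ (N + M - k) = 0" for k
  proof (cases "N \<le> k")
    case True
    then show ?thesis using power_eq_0_mono[OF assms(1)] by simp
  next
    case False
    then show ?thesis using power_eq_0_mono[OF assms(2), of "N + M - k"] by simp
  qed
  then show ?thesis unfolding binomial_ring by (intro sum.neutral) blast
qed

lemma ev_add: "ev (f + g) u = ev f u + ev g u"
  by (cases "finite {n. u ^ n \<noteq> 0}") (simp_all add: nil_eval_def scale_left_distrib sum.distrib)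

lemma ev_diff: "ev (f - g) u = ev f u - ev g u"
  using ev_add[of "f - g" g u] by simp

lemma ev_mult:
  assumes "u ^ N = 0"
  shows "ev (f * g) u = ev f u * ev g u"
proof -
  have z: "scale c (u ^ n) = 0" if "N \<le> n" for n c
    using power_eq_0_mono[OF assms that] by simp
  have "ev (f * g) u = (\<Sum>n<N + N. \<Sum>i\<le>n. scale (f $ i) (u ^ i) * scale (g $ (n - i)) (u ^ (n - i)))"
    unfolding ev_eq[OF power_eq_0_mono[OF assms le_add1[of N N]]]
  proof (intro sum.cong refl)
    fix n
    have "scale (f $ i * g $ (n - i)) (u ^ n) = scale (f $ i) (u ^ i) * scale (g $ (n - i)) (u ^ (n - i))"
      if "i \<le> n" for i
      using that by (simp add: mult_scale mult.commute[of "g $ (n - i)"] flip: scale_mult power_add)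
    then show "scale ((f * g) $ n) (u ^ n) =
        (\<Sum>i\<le>n. scale (f $ i) (u ^ i) * scale (g $ (n - i)) (u ^ (n - i)))"
      by (simp add: fps_mult_nth scale_sum_left atLeast0AtMost)
  qed
  also have "\<dots> = ev f u * ev g u"
    unfolding ev_eq[OF assms] using z by (intro sum_Cauchy_product) auto
  finally show ?thesis .
qed

lemma scale_if: "scale (if P then 1 else 0) x = (if P then x else 0)"
  by simp

lemma ev_1: "u ^ N = 0 \<Longrightarrow> ev 1 u = 1"
  by (cases "N = 0") (auto simp: ev_eq[of u N] scale_if)

lemma ev_power: "u ^ N = 0 \<Longrightarrow> ev (f ^ n) u = ev f u ^ n"
  by (induction n) (simp_all add: ev_1 ev_mult)

lemma ev_X: "u ^ N = 0 \<Longrightarrow> ev fps_X u = u"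
proof -
  assume u: "u ^ N = 0"
  \<comment> \<open>A bound of at least 2 keeps the degree 1 term in range.\<close>
  then have u: "u ^ Suc (Suc N) = 0" by simp
  show ?thesis unfolding ev_eq[OF u] by (simp add: scale_if del: power_Suc sum.lessThan_Suc)
qed

text \<open>The series \<open>g ^ N\<close> has no terms below degree \<open>N\<close>, and from
  there on the powers of \<open>u\<close> vanish.\<close>

lemma ev_nilpotent:
  assumes u: "u ^ N = 0" and "g $ 0 = 0"
  shows "ev g u ^ N = 0"
proof -
  have "(g ^ N) $ n = 0" if "n < N" for n
    using that assms startsby_zero_power_prefix by blast
  then have "ev (g ^ N) u = 0"
    unfolding ev_eq[OF u] by (intro sum.neutral) auto
  then show ?thesis by (simp add: ev_power[OF u])
qed

text \<open>As \<open>g\<close> has no constant term, \<open>g ^ i\<close> has no terms below degree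
  \<open>i\<close>. So only \<open>i < N\<close> contributes to the degrees below \<open>N\<close>,
  and two finite sums are swapped.\<close>

lemma ev_compose:
  assumes u: "u ^ N = 0" and g: "g $ 0 = 0"
  shows "ev (f oo g) u = ev f (ev g u)"
proof -
  have "ev (f oo g) u = (\<Sum>n<N. \<Sum>i<N. scale (f $ i) (scale ((g ^ i) $ n) (u ^ n)))"
  proof -
    have "scale ((f oo g) $ n) (u ^ n) = (\<Sum>i<N. scale (f $ i) (scale ((g ^ i) $ n) (u ^ n)))"
      if "n < N" for n
    proof -
      have "(f oo g) $ n = (\<Sum>i<N. f $ i * (g ^ i) $ n)"
        unfolding fps_compose_nth using that g startsby_zero_power_prefix[of g]
        by (intro sum.mono_neutral_left) auto
      then show ?thesis by (simp add: scale_sum_left)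
    qed
    then show ?thesis unfolding ev_eq[OF u] by (intro sum.cong) auto
  qed
  also have "\<dots> = (\<Sum>i<N. scale (f $ i) (ev (g ^ i) u))"
    unfolding ev_eq[OF u] by (subst sum.swap) (simp add: scale_sum_right)
  also have "\<dots> = ev f (ev g u)"
    by (simp add: ev_eq[OF ev_nilpotent[OF u g]] ev_power[OF u])
  finally show ?thesis .
qed

section \<open>Exponential and logarithm of nilpotent elements\<close>

abbreviation expc :: "'f \<Rightarrow> 'a \<Rightarrow> 'a" where "expc c u \<equiv> ev (fps_exp c) u"

lemma expc_add:
  assumes x: "x ^ N = 0" and y: "y ^ M = 0"
  shows "expc c (x + y) = expc c x * expc c y"
proof -
  have z: "scale b (u ^ n) = 0" if "u ^ K = 0" "K \<le> n" for n b u K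
    using power_eq_0_mono[OF that] by simp
  have "expc c (x + y) = (\<Sum>n<N + M. \<Sum>i\<le>n.
      scale (fps_exp c $ i) (x ^ i) * scale (fps_exp c $ (n - i)) (y ^ (n - i)))"
    unfolding ev_eq[OF nilpotent_add_index[OF x y]]
  proof (intro sum.cong refl)
    fix n
    have "scale (fps_exp c $ n) ((x + y) ^ n) =
      (\<Sum>i\<le>n. scale (fps_exp c $ n * of_nat (n choose i)) (x ^ i * y ^ (n - i)))"
      by (simp only: binomial_ring scale_sum_right scale_scale[symmetric] scale_of_nat mult.assoc)
    also have "\<dots> = (\<Sum>i\<le>n. scale (fps_exp c $ i * fps_exp c $ (n - i)) (x ^ i * y ^ (n - i)))"
    proof (intro sum.cong refl)
      fix i assume "i \<in> {..n}"
      \<comment> \<open>The binomial coefficient divided by n! is 1 / (i! (n - i)!), and the power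
        of \<open>c\<close> splits accordingly.\<close>
      then have "fps_exp c $ n * of_nat (n choose i) = fps_exp c $ i * fps_exp c $ (n - i)"
        by (simp add: binomial_fact field_simps flip: power_add)
      then show "scale (fps_exp c $ n * of_nat (n choose i)) (x ^ i * y ^ (n - i)) =
        scale (fps_exp c $ i * fps_exp c $ (n - i)) (x ^ i * y ^ (n - i))" by (simp only:)
    qed
    finally show "scale (fps_exp c $ n) ((x + y) ^ n) =
        (\<Sum>i\<le>n. scale (fps_exp c $ i) (x ^ i) * scale (fps_exp c $ (n - i)) (y ^ (n - i)))"
      by (simp add: mult_scale mult.commute[of "fps_exp c $ (n - i)" for i] del: fps_exp_nth flip: scale_mult)
  qed
  also have "\<dots> = expc c x * expc c y"
    unfolding ev_eq[OF x] ev_eq[OF y] by (intro sum_Cauchy_product z[OF x] z[OF y])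
  finally show ?thesis .
qed

lemma expc_2:
  assumes "u ^ N = 0" shows "expc 2 u = expc 1 u ^ 2"
  using fps_exp_add_mult[of "1::'f" 1] ev_mult[OF assms, of "fps_exp 1" "fps_exp 1"]
  by (simp add: power2_eq_square)

text \<open>\<open>fps_ln 1\<close> is the series of log (1 + X). Its constant coefficient is 0, so
  leaving out the exponent 0 is harmless. For \<open>u\<close> not nilpotent both sums are infinite,
  hence 0.\<close>

lemma alg_log1_eq: "alg_log1 scale u = ev (fps_ln 1) u"
proof (cases "finite {n. u ^ n \<noteq> 0}")
  case True
  then show ?thesis
    unfolding alg_log1_def nil_eval_def
    by (intro sum.mono_neutral_cong_left)
      (auto simp: fps_ln_nth Suc_le_eq dest!: gr0_implies_Suc)
next
  case False
  moreover have "{n. u ^ n \<noteq> 0} \<subseteq> insert 0 {m. 1 \<le> m \<and> u ^ m \<noteq> 0}"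
    by (auto simp: Suc_le_eq)
  ultimately have "infinite {m. 1 \<le> m \<and> u ^ m \<noteq> 0}"
    using finite_subset by blast
  with False show ?thesis unfolding alg_log1_def nil_eval_def by simp
qed

text \<open>The series exp - 1 and log (1 + X) are inverse under composition, and evaluation
  respects composition.\<close>

lemma expc_log:
  assumes "u ^ N = 0" shows "expc 1 (alg_log1 scale u) = 1 + u"
proof -
  have "(fps_exp 1 - 1) oo fps_ln 1 = (fps_X :: 'f fps)"
    by (simp add: fps_ln_fps_exp_inv fps_inv_fps_exp_compose)
  then have "ev (fps_exp 1 - 1) (alg_log1 scale u) = u"
    using ev_compose[OF assms, of "fps_ln 1" "fps_exp 1 - 1"] ev_X[OF assms]
    by (simp add: alg_log1_eq)
  moreover have "alg_log1 scale u ^ N = 0"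
    using ev_nilpotent[OF assms] by (simp add: alg_log1_eq)
  ultimately show ?thesis by (simp add: ev_diff ev_1 algebra_simps)
qed

lemma log_expc:
  assumes "u ^ N = 0" shows "alg_log1 scale (expc 1 u - 1) = u"
proof -
  have "fps_ln 1 oo (fps_exp 1 - 1) = (fps_X :: 'f fps)"
    by (simp add: fps_ln_fps_exp_inv fps_inv_fps_exp_compose)
  then show ?thesis
    using ev_compose[OF assms, of "fps_exp 1 - 1" "fps_ln 1"] ev_X[OF assms]
    by (simp add: alg_log1_eq ev_diff ev_1[OF assms])
qed

end

section \<open>Structure of Gorenstein algebras\<close>

sublocale gorenstein_algebra \<subseteq> commutative_algebra
  by unfold_locales (rule scale_mult_left)

context gorenstein_algebra
begin

section \<open>Ideals, units and the maximal ideal\<close>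

lemma ideal_subspace: "ring_ideal I \<Longrightarrow> subspace I"
  unfolding ring_ideal_def by (intro subspaceI) (auto, metis scale_conv)

lemma principal_ideal: "ring_ideal (range ((*) x))"
  unfolding ring_ideal_def
proof (intro conjI ballI allI)
  show "0 \<in> range ((*) x)" by (rule range_eqI[of _ _ 0]) simp
next
  fix y z assume "y \<in> range ((*) x)" "z \<in> range ((*) x)"
  then show "y + z \<in> range ((*) x)" by (auto simp flip: distrib_left)
next
  fix a y assume "y \<in> range ((*) x)"
  then show "a * y \<in> range ((*) x)" by (auto simp: mult.left_commute[of a])
qed

lemma dim_le: "dim S \<le> dim UNIV"
  and ideal_eq_of_dim: "ring_ideal I \<Longrightarrow> ring_ideal J \<Longrightarrow> I \<subseteq> J \<Longrightarrow> dim J \<le> dim I \<Longrightarrow> I = J"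
proof -
  obtain B where "finite B" "span B = UNIV" using finite_dim by blast
  moreover obtain C where "C \<subseteq> B" "independent C" "B \<subseteq> span C"
    using maximal_independent_subset[of B] by blast
  moreover have "span B \<subseteq> span C" by (rule span_minimal) (use calculation in simp_all)
  moreover have "finite C" using calculation by (blast intro: finite_subset)
  ultimately interpret finite_dimensional_vector_space scale C
    by unfold_locales blast+
  show "dim S \<le> dim UNIV" by (rule dim_subset) auto
  show "I = J" if "ring_ideal I" "ring_ideal J" "I \<subseteq> J" "dim J \<le> dim I"
    using subspace_dim_equal ideal_subspace that by blast
qed

lemma ideal_eq_UNIV: "ring_ideal I \<Longrightarrow> 1 \<in> I \<Longrightarrow> I = UNIV"
  unfolding ring_ideal_def by (metis mult.right_neutral UNIV_eq_I)

lemma m_ideal: "ring_ideal \<mm>" and one_notin_m: "1 \<notin> \<mm>"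
proof -
  have "maximal_ideal \<mm>" using local_ring by blast
  then show "ring_ideal \<mm>" and "1 \<notin> \<mm>"
    using ideal_eq_UNIV by (auto simp: maximal_ideal_def)
qed

text \<open>Finite dimension replaces Zorn's lemma: a proper ideal of largest dimension among those
  containing \<open>I\<close> is maximal, hence equal to \<open>\<mm>\<close>.\<close>

lemma ideal_subset_m:
  assumes "ring_ideal I" "1 \<notin> I" shows "I \<subseteq> \<mm>"
proof -
  define Q where "Q J \<longleftrightarrow> ring_ideal J \<and> I \<subseteq> J \<and> 1 \<notin> J" for J
  have "Q I" using assms by (simp add: Q_def)
  moreover have "\<forall>J. Q J \<longrightarrow> dim J < Suc (dim UNIV)" using dim_le by (simp add: less_Suc_eq_le)
  ultimately obtain M where M: "Q M" "\<And>J. Q J \<Longrightarrow> dim J \<le> dim M"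
    using ex_has_greatest_nat[of Q I dim] by blast
  have "maximal_ideal M"
    unfolding maximal_ideal_def
  proof (intro conjI allI impI)
    fix J assume J: "ring_ideal J" "M \<subseteq> J"
    show "J = M \<or> J = UNIV"
    proof (cases "1 \<in> J")
      case True
      then show ?thesis using J(1) ideal_eq_UNIV by blast
    next
      case False
      then have "Q J" using J M(1) by (auto simp: Q_def)
      then show ?thesis using ideal_eq_of_dim[of M J] M J by (auto simp: Q_def)
    qed
  qed (use M in \<open>auto simp: Q_def\<close>)
  then show ?thesis using local_ring M(1) by (auto simp: Q_def)
qed

lemma mem_m_iff: "x \<in> \<mm> \<longleftrightarrow> \<not> x dvd 1"
proof
  assume "x \<in> \<mm>"
  then show "\<not> x dvd 1"
    using m_ideal one_notin_m unfolding ring_ideal_def dvd_def by (metis mult.commute)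
next
  assume "\<not> x dvd 1"
  then have "range ((*) x) \<subseteq> \<mm>"
    by (intro ideal_subset_m principal_ideal) (auto simp: dvd_def)
  then show "x \<in> \<mm>" by (metis mult.right_neutral range_subsetD)
qed

lemma m_subspace: "subspace \<mm>"
  by (rule ideal_subspace[OF m_ideal])

lemma m_closed [simp]:
  "0 \<in> \<mm>" "x \<in> \<mm> \<Longrightarrow> y \<in> \<mm> \<Longrightarrow> x + y \<in> \<mm>" "x \<in> \<mm> \<Longrightarrow> y \<in> \<mm> \<Longrightarrow> x - y \<in> \<mm>"
  "x \<in> \<mm> \<Longrightarrow> - x \<in> \<mm>" "x \<in> \<mm> \<Longrightarrow> scale c x \<in> \<mm>" "x \<in> \<mm> \<Longrightarrow> x * r \<in> \<mm>" "x \<in> \<mm> \<Longrightarrow> r * x \<in> \<mm>"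
  using m_subspace m_ideal
  by (auto simp: subspace_add subspace_0 subspace_diff subspace_neg subspace_scale ring_ideal_def
      mult.commute[of x r])

section \<open>Nilpotency, the annihilator and the residue field\<close>

lemma mult_one_minus_eq_0:
  assumes "u \<in> \<mm>" "z * (1 - u) = 0" shows "z = 0"
proof -
  have "1 - u \<notin> \<mm>" using m_closed(2)[OF _ assms(1), of "1 - u"] one_notin_m by auto
  then obtain v where "1 = (1 - u) * v" unfolding mem_m_iff dvd_def by auto
  then have "z = z * (1 - u) * v" by (metis mult.assoc mult.right_neutral)
  then show ?thesis using assms(2) by simp
qed

lemma eq_mult_of_dim:
  assumes "dim (range ((*) z)) \<le> dim (range ((*) (z * u)))" shows "\<exists>s. z = z * u * s"
proof -
  have "range ((*) (z * u)) = range ((*) z)"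
    using assms by (intro ideal_eq_of_dim principal_ideal) (auto simp: mult.assoc)
  then show ?thesis by (metis mult.right_neutral rangeE rangeI)
qed

text \<open>If the ideal generated by \<open>u ^ N\<close> has least dimension, it is also generated
  by \<open>u ^ Suc N\<close>, so \<open>u ^ N\<close> is killed by a unit of the form
  \<open>1 - u * s\<close>.\<close>

lemma m_nilpotent:
  assumes "u \<in> \<mm>" obtains N where "u ^ N = 0"
proof -
  obtain N where "\<And>n. dim (range ((*) (u ^ N))) \<le> dim (range ((*) (u ^ n)))"
    using ex_has_least_nat[of "\<lambda>_. True" 0 "\<lambda>n. dim (range ((*) (u ^ n)))"] by blast
  from this[of "Suc N"] obtain s where "u ^ N = u ^ N * u * s"
    using eq_mult_of_dim[of "u ^ N" u] by (auto simp: mult.commute)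
  then have "u ^ N * (1 - u * s) = 0" by (simp add: algebra_simps)
  then show thesis using mult_one_minus_eq_0[of "u * s"] assms that m_closed(6) by blast
qed

text \<open>A nonzero multiple of \<open>z\<close> with principal ideal of least dimension lies in
  the annihilator: a further nonzero product with \<open>u\<close> would generate the same ideal,
  and the unit \<open>1 - u * s\<close> would kill the multiple.\<close>

lemma multiple_in_Ann:
  assumes z: "z \<in> \<mm>" "z \<noteq> 0" obtains r where "z * r \<noteq> 0" "z * r \<in> Ann \<mm>"
proof -
  obtain r where r: "z * r \<noteq> 0"
    and min: "\<And>s. z * s \<noteq> 0 \<Longrightarrow> dim (range ((*) (z * r))) \<le> dim (range ((*) (z * s)))"
    using ex_has_least_nat[of "\<lambda>r. z * r \<noteq> 0" 1 "\<lambda>r. dim (range ((*) (z * r)))"] z by auto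
  have "z * r * u = 0" if u: "u \<in> \<mm>" for u
  proof (rule ccontr)
    assume "z * r * u \<noteq> 0"
    then obtain s where "z * r = z * r * u * s"
      using min[of "r * u"] eq_mult_of_dim[of "z * r" u] by (auto simp: mult.assoc)
    moreover have "z * r * (1 - u * s) = z * r - z * r * u * s" by (simp add: algebra_simps)
    ultimately have "z * r * (1 - u * s) = 0" by (metis diff_self)
    then show False using mult_one_minus_eq_0[of "u * s"] u r m_closed(6) by blast
  qed
  then show thesis using z r that by (auto simp: Ann_def)
qed

lemma Ann_generator: obtains a where "a \<noteq> 0" "Ann \<mm> = range (\<lambda>c. scale c a)"
proof -
  obtain B where B: "B \<subseteq> Ann \<mm>" "independent B" "Ann \<mm> \<subseteq> span B" "card B = 1"
    using basis_exists[of "Ann \<mm>"] dim_Ann by metis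
  then obtain a where a: "B = {a}" by (auto simp: card_1_singleton_iff)
  have "subspace (Ann \<mm>)"
    by (intro subspaceI) (auto simp: Ann_def distrib_right scale_mult[symmetric])
  then have "Ann \<mm> = span {a}" using B a by (intro subset_antisym span_minimal) auto
  then have "Ann \<mm> = range (\<lambda>c. scale c a)" by (simp add: span_singleton)
  moreover have "a \<noteq> 0" using B a dependent_zero by blast
  ultimately show thesis using that by blast
qed

text \<open>The residue field is the scalar field: \<open>x\<close> acts on the one-dimensional
  annihilator as a scalar \<open>c\<close>, so \<open>x - scale c 1\<close> kills a nonzero element
  and is not a unit.\<close>

lemma residue_scalar: obtains c where "x - scale c 1 \<in> \<mm>"
proof -
  obtain a where a: "a \<noteq> 0" "Ann \<mm> = range (\<lambda>c. scale c a)" by (rule Ann_generator)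
  then have aA: "a \<in> Ann \<mm>" using scale_one[of a] by (metis rangeI)
  then have "x * a \<in> Ann \<mm>" by (auto simp: Ann_def mult.assoc)
  then obtain c where "x * a = scale c a" using a by auto
  then have 0: "(x - scale c 1) * a = 0" by (simp add: left_diff_distrib flip: scale_mult)
  have "x - scale c 1 \<in> \<mm>"
  proof (rule ccontr)
    assume "x - scale c 1 \<notin> \<mm>"
    then obtain v where v: "1 = (x - scale c 1) * v" by (auto simp: mem_m_iff dvd_def)
    have "a = (x - scale c 1) * a * v" by (metis v mult.assoc mult.commute mult.right_neutral)
    then show False using 0 a(1) by simp
  qed
  then show thesis using that by blast
qed

lemma scale_one_in_m_iff: "scale c 1 \<in> \<mm> \<longleftrightarrow> c = 0"
  using m_closed(5)[of "scale c 1" "inverse c"] one_notin_m by (cases "c = 0") auto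

section \<open>Exponential and logarithm on the maximal ideal\<close>

lemma expc_minus_1_in_m [simp]:
  assumes "u \<in> \<mm>" shows "expc c u - 1 \<in> \<mm>"
proof -
  obtain N where N: "u ^ N = 0" using m_nilpotent[OF assms] .
  have "u ^ Suc N = 0" using N by simp
  then have "expc c u = (\<Sum>n<Suc N. scale (fps_exp c $ n) (u ^ n))" by (rule ev_eq)
  also have "\<dots> = 1 + (\<Sum>n<N. scale (fps_exp c $ Suc n) (u ^ Suc n))"
    by (subst sum.lessThan_Suc_shift) simp
  moreover have "(\<Sum>n<N. scale (fps_exp c $ Suc n) (u ^ Suc n)) \<in> \<mm>"
    using assms by (intro subspace_sum[OF m_subspace]) simp
  ultimately show ?thesis by simp
qed

lemma expc_add_m: "x \<in> \<mm> \<Longrightarrow> y \<in> \<mm> \<Longrightarrow> expc c (x + y) = expc c x * expc c y"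
  using m_nilpotent expc_add by metis

lemma alg_log1_in_m:
  assumes "u \<in> \<mm>" shows "alg_log1 scale u \<in> \<mm>"
  unfolding alg_log1_def using assms
  by (intro subspace_sum[OF m_subspace] m_closed) (auto simp: Suc_le_eq gr0_conv_Suc)

lemma expc_0 [simp]: "expc c 0 = 1"
  using ev_eq[of 0 1 "fps_exp c"] by simp

lemma expc_Ann:
  assumes "z \<in> Ann \<mm>" shows "expc c z = 1 + scale c z"
proof -
  have "z ^ 2 = 0" using assms by (auto simp: Ann_def power2_eq_square)
  from ev_eq[OF this] show ?thesis by (simp add: numeral_2_eq_2)
qed

text \<open>Half the logarithm of 1 + \<open>v\<close> is a preimage.\<close>

lemma expc_2_surj:
  assumes "v \<in> \<mm>" obtains x where "x \<in> \<mm>" "expc 2 x = 1 + v"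
proof -
  let ?l = "alg_log1 scale v"
  define x where "x = scale (1/2) ?l"
  have x: "x \<in> \<mm>" using alg_log1_in_m[OF assms] by (simp add: x_def)
  have "expc 2 x = expc 1 x * expc 1 x"
    using m_nilpotent[OF x] expc_2[of x] by (metis power2_eq_square)
  also have "\<dots> = expc 1 (x + x)" using expc_add_m[OF x x] by simp
  also have "x + x = ?l" by (simp add: x_def flip: scale_left_distrib)
  also have "expc 1 ?l = 1 + v" using m_nilpotent[OF assms] expc_log by metis
  finally show thesis using x that by blast
qed

lemma expc_2_inj:
  assumes "x \<in> \<mm>" "y \<in> \<mm>" "expc 2 x = expc 2 y" shows "x = y"
proof -
  have *: "alg_log1 scale (expc 2 u - 1) = scale 2 u" if "u \<in> \<mm>" for u
  proof -
    have "expc 2 u = expc 1 u * expc 1 u"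
      using m_nilpotent[OF that] expc_2[of u] by (metis power2_eq_square)
    also have "\<dots> = expc 1 (u + u)" using expc_add_m[OF that that] by simp
    finally have "alg_log1 scale (expc 2 u - 1) = u + u"
      using m_nilpotent[of "u + u"] log_expc[of "u + u"] that by (metis m_closed(2))
    then show ?thesis by (simp add: scale_2)
  qed
  then have "scale 2 x = scale 2 y" using assms by metis
  then show ?thesis by simp
qed

lemma log_quadric:
  "alg_log1 scale ` quadric \<mm> \<pi> = {y \<in> \<mm>. \<pi> (expc 2 y - 1) = 0}" (is "_ = ?S")
proof
  have *: "2 * u + u\<^sup>2 = expc 2 y - 1" if "y \<in> \<mm>" "expc 1 y = 1 + u" for u y
  proof -
    have "expc 2 y = (1 + u)\<^sup>2" using m_nilpotent[OF that(1)] expc_2[of y] that(2) by metis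
    then show ?thesis by (simp add: power2_eq_square algebra_simps)
  qed
  show "alg_log1 scale ` quadric \<mm> \<pi> \<subseteq> ?S"
  proof safe
    fix u assume "u \<in> quadric \<mm> \<pi>"
    then have u: "u \<in> \<mm>" "\<pi> (2 * u + u\<^sup>2) = 0" by (auto simp: quadric_def)
    show l: "alg_log1 scale u \<in> \<mm>" by (rule alg_log1_in_m[OF u(1)])
    have "expc 1 (alg_log1 scale u) = 1 + u" using m_nilpotent[OF u(1)] expc_log by metis
    with l u show "\<pi> (expc 2 (alg_log1 scale u) - 1) = 0" by (simp add: *)
  qed
  show "?S \<subseteq> alg_log1 scale ` quadric \<mm> \<pi>"
  proof safe
    fix y assume y: "y \<in> \<mm>" "\<pi> (expc 2 y - 1) = 0"
    have e: "2 * (expc 1 y - 1) + (expc 1 y - 1)\<^sup>2 = expc 2 y - 1"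
      by (rule *[OF y(1)]) simp
    have "expc 1 y - 1 \<in> quadric \<mm> \<pi>"
      unfolding quadric_def mem_Collect_eq e using y by simp
    moreover have "alg_log1 scale (expc 1 y - 1) = y" using m_nilpotent[OF y(1)] log_expc by metis
    ultimately show "y \<in> alg_log1 scale ` quadric \<mm> \<pi>" by (metis imageI)
  qed
qed

end

section \<open>The defining function of the hypersurface\<close>

text \<open>\<open>\<omega>\<close> stands for the coordinate of the projection along a generator of
  the annihilator. Keeping it abstract permits a second form on the same algebra, such as
  \<open>f\<close> in \<open>form_power_eq\<close>.\<close>

locale gorenstein_form = gorenstein_algebra scale \<mm>
  for scale :: "'f::field_char_0 \<Rightarrow> 'a::comm_ring_1 \<Rightarrow> 'a" and \<mm> +
  fixes \<omega> :: "'a \<Rightarrow> 'f" and a :: 'a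
  assumes form: "linear_between scale \<mm> (*) UNIV \<omega>"
    and Ann_eq: "Ann \<mm> = range (\<lambda>c. scale c a)"
    and form_a [simp]: "\<omega> a = 1"
begin

lemmas form_add = linear_between_add[OF form]
lemmas form_scale = linear_between_scale[OF form]
lemmas form_diff = linear_between_diff[OF form]

lemma form_0 [simp]: "\<omega> 0 = 0"
  using linear_between_zero[OF form] by simp

lemma a_Ann: "a \<in> Ann \<mm>"
  using scale_one[of a] unfolding Ann_eq by (metis rangeI)

lemma a_in_m [simp]: "a \<in> \<mm>" and mult_a [simp]: "x \<in> \<mm> \<Longrightarrow> x * a = 0"
  using a_Ann by (auto simp: Ann_def mult.commute)

lemma Ann_form: "z \<in> Ann \<mm> \<Longrightarrow> z = scale (\<omega> z) a"
  unfolding Ann_eq by (auto simp: form_scale)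

text \<open>Otherwise some \<open>z * w\<close> is nonzero and has a nonzero multiple on the line
  spanned by \<open>a\<close>, where \<open>\<omega>\<close> is injective. This multiple is still
  \<open>z\<close> times an element of \<open>\<mm>\<close>.\<close>

lemma form_nondegenerate:
  assumes z: "z \<in> \<mm>" "\<And>w. w \<in> \<mm> \<Longrightarrow> \<omega> (z * w) = 0" shows "z \<in> Ann \<mm>"
proof (rule ccontr)
  assume "z \<notin> Ann \<mm>"
  then obtain w where w: "w \<in> \<mm>" "z * w \<noteq> 0" using z by (auto simp: Ann_def)
  then obtain r where r: "z * w * r \<noteq> 0" "z * w * r \<in> Ann \<mm>"
    using multiple_in_Ann[of "z * w"] z(1) by auto
  have "\<omega> (z * w * r) = 0" using z(2)[of "w * r"] w by (simp add: mult.assoc)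
  then show False using Ann_form[OF r(2)] r(1) by simp
qed

text \<open>The forms given by multiplication with the elements of a finite spanning set have no
  common zero in \<open>\<mm>\<close> except 0, so every form on \<open>\<mm>\<close> is a
  combination of them.\<close>

lemma form_representable:
  assumes f: "linear_between scale \<mm> (*) UNIV f"
  obtains b where "\<And>z. z \<in> \<mm> \<Longrightarrow> f z = \<omega> (b * z)"
proof -
  obtain E where E: "finite E" "span E = UNIV" using finite_dim by blast
  have "\<exists>c. \<forall>z\<in>\<mm>. f z = (\<Sum>e\<in>E. c e * \<omega> (e * z))"
  proof (rule linear_form_eq_sum[OF E(1) m_subspace vector_space_axioms _ f])
    show "linear_between scale \<mm> (*) UNIV (\<lambda>z. \<omega> (e * z))" for e
      unfolding linear_between_def by (auto simp: distrib_left form_add mult_scale form_scale)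
    fix z assume z: "z \<in> \<mm>" "\<And>e. e \<in> E \<Longrightarrow> \<omega> (e * z) = 0"
    have "subspace {x. \<omega> (x * z) = 0}"
      using z(1) by (intro subspaceI)
        (auto simp: distrib_right form_add form_scale simp flip: scale_mult)
    then have "span E \<subseteq> {x. \<omega> (x * z) = 0}" using z(2) by (intro span_minimal) auto
    then have 0: "\<omega> (x * z) = 0" for x using E(2) by auto
    then have "z \<in> Ann \<mm>" using z(1) form_nondegenerate[of z] by (simp add: mult.commute)
    \<comment> \<open>Nondegeneracy leaves a multiple of \<open>a\<close>; taking 1 for the factor
      shows that its coefficient is 0.\<close>
    then have "z = 0" using Ann_form[of z] 0[of 1] by simp
    then show "f z = 0" using linear_between_zero[OF f] by simp
  qed
  then obtain c where c: "\<And>z. z \<in> \<mm> \<Longrightarrow> f z = (\<Sum>e\<in>E. c e * \<omega> (e * z))" by blast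
  have "f z = \<omega> ((\<Sum>e\<in>E. scale (c e) e) * z)" if "z \<in> \<mm>" for z
  proof -
    have "\<omega> ((\<Sum>e\<in>E. scale (c e) e) * z) = \<omega> (\<Sum>e\<in>E. scale (c e) (e * z))"
      by (simp add: sum_distrib_right scale_mult)
    also have "\<dots> = (\<Sum>e\<in>E. c e * \<omega> (e * z))"
      using that by (subst linear_between_sum[OF form]) (auto simp: form_scale)
    finally show ?thesis using c[OF that] by simp
  qed
  then show thesis using that by blast
qed

section \<open>The defining function under translations\<close>

definition defining_fun :: "'a \<Rightarrow> 'f" where
  "defining_fun y = \<omega> (expc 2 y - 1)"

lemma defining_fun_add:
  assumes x: "x \<in> \<mm>" and d: "d \<in> \<mm>"
  shows "defining_fun (x + d) = defining_fun x + \<omega> (expc 2 x * (expc 2 d - 1))"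
proof -
  have e: "expc 2 (x + d) - 1 = (expc 2 x - 1) + expc 2 x * (expc 2 d - 1)"
    unfolding expc_add_m[OF x d] by (simp add: algebra_simps)
  show ?thesis
    unfolding defining_fun_def e using x d by (intro form_add) simp_all
qed

text \<open>On the annihilator the exponential is affine, and exp (2y) fixes \<open>a\<close>
  because exp (2y) - 1 lies in \<open>\<mm>\<close>.\<close>

lemma defining_fun_add_a:
  assumes y: "y \<in> \<mm>"
  shows "defining_fun (y + scale t a) = defining_fun y + 2 * t"
proof -
  have "scale t a \<in> Ann \<mm>" by (auto simp: Ann_eq)
  then have "expc 2 y * (expc 2 (scale t a) - 1) = scale (2 * t) (expc 2 y * a)"
    by (simp add: expc_Ann mult_scale)
  also have "expc 2 y * a = a"
    using mult_a[OF expc_minus_1_in_m[OF y, of 2]] by (simp add: algebra_simps)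
  finally show ?thesis using defining_fun_add[OF y, of "scale t a"] by (simp add: form_scale)
qed

lemma defining_fun_0 [simp]: "defining_fun 0 = 0"
  by (simp add: defining_fun_def)

text \<open>The hypersurface is a graph along the lines in direction \<open>d\<close> only if \<open>d\<close> lies in the
  annihilator: otherwise \<open>\<omega> (exp (2x + 2d)) = \<omega> (exp 2x)\<close> for a suitable \<open>x\<close>.\<close>

lemma Ann_if_no_translate:
  assumes d: "d \<in> \<mm>"
    and no: "\<And>y. y \<in> \<mm> \<Longrightarrow> defining_fun y = 0 \<Longrightarrow> defining_fun (y + d) \<noteq> 0"
  shows "d \<in> Ann \<mm>"
proof (rule ccontr)
  assume nd: "d \<notin> Ann \<mm>"
  define w where "w = expc 2 d - 1"
  have w: "w \<in> \<mm>" using d by (simp add: w_def)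
  \<comment> \<open>Otherwise exp (2d) = 1 + w = exp (2 (w/2)), and injectivity gives d = w/2,
    against \<open>nd\<close>.\<close>
  have "w \<notin> Ann \<mm>"
  proof
    assume wA: "w \<in> Ann \<mm>"
    then have hA: "scale (1/2) w \<in> Ann \<mm>"
      unfolding Ann_def by (auto simp flip: scale_mult)
    have "expc 2 d = expc 2 (scale (1/2) w)"
      using expc_Ann[OF hA, of 2] by (simp add: w_def)
    then have "d = scale (1/2) w" using expc_2_inj[OF d] w by simp
    then show False using hA nd by simp
  qed
  then obtain u where u: "u \<in> \<mm>" "\<omega> (w * u) \<noteq> 0" using form_nondegenerate[OF w] by blast
  \<comment> \<open>The factor makes \<open>\<omega>\<close> vanish on (1 + v) w. With exp (2x) = 1
    + v, this is the increment of P from \<open>x\<close> to \<open>x + d\<close>.\<close>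
  define v where "v = scale (- \<omega> w / \<omega> (w * u)) u"
  have v: "v \<in> \<mm>" using u by (simp add: v_def)
  have "\<omega> ((1 + v) * w) = \<omega> (w + scale (- \<omega> w / \<omega> (w * u)) (w * u))"
    by (simp add: v_def distrib_right mult.commute[of w] flip: scale_mult del: scale_minus_left)
  also have "\<dots> = 0" using w u by (simp add: form_diff form_scale)
  finally have 0: "\<omega> ((1 + v) * w) = 0" .
  obtain x where x: "x \<in> \<mm>" "expc 2 x = 1 + v" using expc_2_surj[OF v] .
  have xd: "defining_fun (x + d) = defining_fun x"
    using defining_fun_add[OF x(1) d] 0 x(2) by (simp add: w_def)
  \<comment> \<open>Translation by \<open>scale t a\<close> lowers the common value at
    \<open>x\<close> and \<open>x + d\<close> to 0.\<close>
  define t where "t = - defining_fun x / 2"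
  have "defining_fun (x + scale t a) = 0"
    using defining_fun_add_a[OF x(1), of t] by (simp add: t_def)
  moreover have "defining_fun (x + scale t a + d) = 0"
    using defining_fun_add_a[of "x + d" t] x(1) d xd by (simp add: t_def algebra_simps)
  ultimately show False using no[of "x + scale t a"] x(1) by simp
qed

text \<open>The factor \<open>e\<close> representing \<open>f\<close> is a unit, up to a scalar
  equal to exp (2 \<open>b0\<close>). Multiplication by exp (2 \<open>b0\<close>) acts on P as
  translation by \<open>b0\<close> up to a constant.\<close>

lemma zero_set_translate:
  assumes f: "linear_between scale \<mm> (*) UNIV f" and fa: "f a \<noteq> 0"
  obtains b where "b \<in> \<mm>" "\<And>y. y \<in> \<mm> \<Longrightarrow> f (expc 2 y - 1) = 0 \<longleftrightarrow> defining_fun (y + b) = 0"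
proof -
  obtain e where e: "\<And>z. z \<in> \<mm> \<Longrightarrow> f z = \<omega> (e * z)" using form_representable[OF f] by blast
  obtain k where k: "e - scale k 1 \<in> \<mm>" using residue_scalar .
  \<comment> \<open>If \<open>k\<close> were 0, then \<open>e\<close> would lie in
    \<open>\<mm>\<close> and kill \<open>a\<close>.\<close>
  have k0: "k \<noteq> 0"
    using k e[of a] fa by auto
  define v where "v = scale (1 / k) (e - scale k 1)"
  have v: "v \<in> \<mm>" using k by (simp add: v_def)
  have ev: "e = scale k (1 + v)" using k0 by (simp add: v_def scale_right_distrib)
  obtain b0 where b0: "b0 \<in> \<mm>" "expc 2 b0 = 1 + v" using expc_2_surj[OF v] .
  \<comment> \<open>The multiple of \<open>a\<close> subtracts the constant
    P(\<open>b0\<close>).\<close>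
  define b where "b = b0 + scale (- defining_fun b0 / 2) a"
  have "f (expc 2 y - 1) = 0 \<longleftrightarrow> defining_fun (y + b) = 0" if y: "y \<in> \<mm>" for y
  proof -
    have "f (expc 2 y - 1) = k * \<omega> (expc 2 b0 * (expc 2 y - 1))"
      using y e[of "expc 2 y - 1"] ev b0(2) by (simp add: form_scale flip: scale_mult)
    also have "\<omega> (expc 2 b0 * (expc 2 y - 1)) = defining_fun (y + b0) - defining_fun b0"
      using defining_fun_add[OF b0(1) y] by (simp add: add.commute)
    also have "\<dots> = defining_fun (y + b)"
      using defining_fun_add_a[of "y + b0" "- defining_fun b0 / 2"] y b0(1)
      by (simp add: b_def algebra_simps)
    finally show ?thesis using k0 by simp
  qed
  moreover have "b \<in> \<mm>" using b0 by (simp add: b_def)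
  ultimately show thesis using that by blast
qed

section \<open>Homogeneous parts of the defining function and polarisation\<close>

lemma power_scale: "scale t y ^ n = scale (t ^ n) (y ^ n)"
  by (induction n) (simp_all add: mult_scale flip: scale_mult)

text \<open>The function t -> P(ty) as a polynomial. A free cut-off \<open>M\<close> lets the
  polynomials of two algebras have the same length; the degrees start at 1 because P(0) = 0.\<close>

definition defining_poly :: "nat \<Rightarrow> 'a \<Rightarrow> 'f poly" where
  "defining_poly M y = (\<Sum>n<M. monom (fps_exp 2 $ Suc n * \<omega> (y ^ Suc n)) (Suc n))"

lemma coeff_defining_poly:
  "n < M \<Longrightarrow> coeff (defining_poly M y) (Suc n) = fps_exp 2 $ Suc n * \<omega> (y ^ Suc n)"
  by (simp add: defining_poly_def coeff_sum del: fps_exp_nth power_Suc)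

lemma poly_defining_poly:
  assumes y: "y \<in> \<mm>" and M: "y ^ Suc M = 0"
  shows "poly (defining_poly M y) t = defining_fun (scale t y)"
proof -
  have "scale t y ^ Suc M = 0" using M by (simp add: power_scale del: power_Suc)
  from ev_eq[OF this, of "fps_exp 2"]
  have "expc 2 (scale t y) - 1 = (\<Sum>n<M. scale (fps_exp 2 $ Suc n) (scale t y ^ Suc n))"
    by (subst (asm) sum.lessThan_Suc_shift) (simp del: power_Suc)
  also have "\<dots> = (\<Sum>n<M. scale (fps_exp 2 $ Suc n * t ^ Suc n) (y ^ Suc n))"
    by (simp only: power_scale scale_scale)
  finally have "defining_fun (scale t y) = (\<Sum>n<M. (fps_exp 2 $ Suc n * t ^ Suc n) * \<omega> (y ^ Suc n))"
    unfolding defining_fun_def using y by (simp add: linear_between_sum[OF form] form_scale)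
  then show ?thesis
    by (simp add: defining_poly_def poly_sum poly_monom mult.assoc mult.left_commute mult.commute)
qed

lemma form_polar2:
  assumes "x \<in> \<mm>" "y \<in> \<mm>"
  shows "\<omega> ((x + y) ^ 2) = \<omega> (x ^ 2) + \<omega> (y ^ 2) + 2 * \<omega> (x * y)"
proof -
  have "2 * \<omega> (x * y) = \<omega> (2 * (x * y))" using assms by (simp add: form_scale flip: scale_2)
  then show ?thesis
    using assms by (simp add: power2_eq_square algebra_simps flip: form_add)
qed

text \<open>Inclusion-exclusion for the cube, arranged without subtraction so that additivity merges
  each side into one value of \<open>\<omega>\<close>.\<close>

lemma form_polar3:
  assumes "x \<in> \<mm>" "y \<in> \<mm>" "z \<in> \<mm>"
  shows "\<omega> ((x + y + z) ^ 3) + \<omega> (x ^ 3) + \<omega> (y ^ 3) + \<omega> (z ^ 3) =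
    \<omega> ((x + y) ^ 3) + \<omega> ((y + z) ^ 3) + \<omega> ((x + z) ^ 3) + 6 * \<omega> (x * y * z)"
proof -
  have "6 * \<omega> (x * y * z) = \<omega> (6 * (x * y * z))"
    using assms scale_of_nat[of 6 "x * y * z"] by (simp flip: form_scale)
  then show ?thesis
    using assms by (simp add: power3_eq_cube algebra_simps flip: form_add)
qed

end

lemma (in gorenstein_algebra) admissible_projection_form:
  assumes "admissible_projection scale \<mm> \<pi>"
  obtains \<omega> a where "gorenstein_form scale \<mm> \<omega> a"
    and "hypersurface scale \<mm> \<pi> = {y \<in> \<mm>. gorenstein_form.defining_fun scale \<omega> y = 0}"
proof -
  have lin: "linear_between scale \<mm> scale \<mm> \<pi>" and idem: "\<And>u. u \<in> \<mm> \<Longrightarrow> \<pi> (\<pi> u) = \<pi> u"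
    and im: "\<pi> ` \<mm> = Ann \<mm>"
    using assms by (auto simp: admissible_projection_def)
  obtain a where a: "a \<noteq> 0" "Ann \<mm> = range (\<lambda>c. scale c a)" by (rule Ann_generator)
  have "\<exists>c. \<pi> u = scale c a" if "u \<in> \<mm>" for u using im a(2) that by auto
  then obtain \<omega> where \<omega>: "\<And>u. u \<in> \<mm> \<Longrightarrow> \<pi> u = scale (\<omega> u) a" by metis
  have aA: "a \<in> Ann \<mm>" using scale_one[of a] a(2) by (metis rangeI)
  then have am: "a \<in> \<mm>" by (simp add: Ann_def)
  have inj: "scale c a = scale d a \<longleftrightarrow> c = d" for c d using a(1) by simp
  interpret gorenstein_form scale \<mm> \<omega> a
  proof
    have "\<omega> (x + y) = \<omega> x + \<omega> y" if "x \<in> \<mm>" "y \<in> \<mm>" for x y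
    proof -
      have "scale (\<omega> (x + y)) a = scale (\<omega> x + \<omega> y) a"
        using that linear_between_add[OF lin that] by (simp add: scale_left_distrib flip: \<omega>)
      then show ?thesis using inj by blast
    qed
    moreover have "\<omega> (scale c x) = c * \<omega> x" if "x \<in> \<mm>" for x c
    proof -
      have "scale (\<omega> (scale c x)) a = scale (c * \<omega> x) a"
        using that linear_between_scale[OF lin that, of c]
        by (simp flip: \<omega> scale_scale)
      then show ?thesis using inj by blast
    qed
    ultimately show "linear_between scale \<mm> (*) UNIV \<omega>" by (simp add: linear_between_def)
    \<comment> \<open>A projection fixes its range, so the coordinate of \<open>a\<close> is
      1.\<close>
    obtain w where "w \<in> \<mm>" "a = \<pi> w" using aA im by blast
    then have "\<pi> a = a" using idem by simp
    then show "\<omega> a = 1" using \<omega>[OF am] a(1) inj[of "\<omega> a" 1] by simp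
  qed (rule a(2))
  have "hypersurface scale \<mm> \<pi> = {y \<in> \<mm>. defining_fun y = 0}"
    unfolding hypersurface_def log_quadric defining_fun_def
    using a(1) by (auto simp: \<omega>)
  then show thesis using that gorenstein_form_axioms by blast
qed

section \<open>Affine equivalence and isomorphism\<close>

locale gorenstein_form_pair =
  A: gorenstein_form scale \<mm> \<omega> a + B: gorenstein_form scale' \<mm>' \<omega>' a'
  for scale :: "'f::field_char_0 \<Rightarrow> 'a::comm_ring_1 \<Rightarrow> 'a" and \<mm> \<omega> a
    and scale' :: "'f \<Rightarrow> 'b::comm_ring_1 \<Rightarrow> 'b" and \<mm>' \<omega>' a'
begin

text \<open>By comparing the coefficients of the polynomials \<open>t \<mapsto> f (exp (2 t L y) - 1)\<close> and
  \<open>t \<mapsto> k \<omega> (exp (2 t y) - 1)\<close>.\<close>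

lemma form_power_eq:
  assumes L: "linear_between scale \<mm> scale' \<mm>' L"
    and f: "linear_between scale' \<mm>' (*) UNIV f" and fa: "f a' = 1"
    and eq: "\<And>y. y \<in> \<mm> \<Longrightarrow> f (B.expc 2 (L y) - 1) = k * A.defining_fun y"
    and y: "y \<in> \<mm>" and n: "n > 0"
  shows "f (L y ^ n) = k * \<omega> (y ^ n)"
proof -
  interpret F: gorenstein_form scale' \<mm>' f a'
    using f fa B.Ann_eq by unfold_locales
  have Ly: "L y \<in> \<mm>'" by (rule linear_between_in[OF L y])
  obtain N N' where N: "y ^ N = 0" "L y ^ N' = 0"
    using A.m_nilpotent[OF y] B.m_nilpotent[OF Ly] by metis
  \<comment> \<open>One bound for both nilpotency indices that also includes the coefficient of
    degree \<open>n\<close>.\<close>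
  define M where "M = N + N' + n"
  have M: "y ^ Suc M = 0" "L y ^ Suc M = 0"
    by (rule power_eq_0_mono[OF N(1)] power_eq_0_mono[OF N(2)], simp add: M_def)+
  have "poly (F.defining_poly M (L y)) t = poly (smult k (A.defining_poly M y)) t" for t
    using eq[of "scale t y"] y Ly M linear_between_scale[OF L y, of t]
    by (simp add: A.poly_defining_poly F.poly_defining_poly F.defining_fun_def)
  \<comment> \<open>A field of characteristic zero is infinite, so equal values at all
    \<open>t\<close> give equal polynomials.\<close>
  then have p: "F.defining_poly M (L y) = smult k (A.defining_poly M y)"
    by (simp add: poly_eq_poly_eq_iff[symmetric] fun_eq_iff)
  obtain m where m: "n = Suc m" "m < M" using n by (cases n) (auto simp: M_def)
  have "fps_nth (fps_exp (2::'f)) (Suc m) \<noteq> 0" by (simp del: fact_Suc)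
  moreover have "fps_nth (fps_exp 2) (Suc m) * f (L y ^ Suc m) =
      k * (fps_nth (fps_exp 2) (Suc m) * \<omega> (y ^ Suc m))"
    using arg_cong[OF p, of "\<lambda>q. coeff q (Suc m)"] m(2)
    by (simp only: coeff_smult A.coeff_defining_poly F.coeff_defining_poly)
  ultimately show ?thesis unfolding m(1) by (metis mult.left_commute mult_left_cancel)
qed

text \<open>By \<open>two\<close> and \<open>three\<close>, \<open>f\<close> takes the value k
  \<omega>(xyv) on both L x L y L v and L (xy) L v.\<close>

lemma mult_hom:
  assumes L: "linear_between scale \<mm> scale' \<mm>' L" and L_surj: "L ` \<mm> = \<mm>'"
    and f: "linear_between scale' \<mm>' (*) UNIV f" and fa: "f a' = 1"
    and eq: "\<And>y. y \<in> \<mm> \<Longrightarrow> f (B.expc 2 (L y) - 1) = k * A.defining_fun y"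
    and x: "x \<in> \<mm>" and y: "y \<in> \<mm>"
  shows "L (x * y) = L x * L y"
proof -
  interpret F: gorenstein_form scale' \<mm>' f a'
    using f fa B.Ann_eq by unfold_locales
  note pow = form_power_eq[OF L f fa eq]
  note L_in = linear_between_in[OF L] and L_add = linear_between_add[OF L]
  have two: "f (L u * L v) = k * \<omega> (u * v)" if "u \<in> \<mm>" "v \<in> \<mm>" for u v
  proof -
    have "f ((L u + L v)\<^sup>2) = k * \<omega> ((u + v)\<^sup>2)"
      using pow[of "u + v" 2] that by (simp add: L_add)
    then have "2 * f (L u * L v) = 2 * (k * \<omega> (u * v))"
      using that pow[of u 2] pow[of v 2]
      by (simp add: A.form_polar2 F.form_polar2 L_in algebra_simps)
    then show ?thesis by simp
  qed
  have three: "f (L u * L v * L w) = k * \<omega> (u * v * w)" if "u \<in> \<mm>" "v \<in> \<mm>" "w \<in> \<mm>" for u v w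
  proof -
    have *: "f ((L u + L v) ^ 3) = k * \<omega> ((u + v) ^ 3)" if "u \<in> \<mm>" "v \<in> \<mm>" for u v
      using pow[of "u + v" 3] that by (simp add: L_add)
    have "f ((L u + L v + L w) ^ 3) = k * \<omega> ((u + v + w) ^ 3)"
      using pow[of "u + v + w" 3] that by (simp add: L_add)
    moreover have "k * (\<omega> ((u + v + w) ^ 3) + \<omega> (u ^ 3) + \<omega> (v ^ 3) + \<omega> (w ^ 3)) =
        k * (\<omega> ((u + v) ^ 3) + \<omega> ((v + w) ^ 3) + \<omega> ((u + w) ^ 3) + 6 * \<omega> (u * v * w))"
      using that by (simp only: A.form_polar3)
    moreover note F.form_polar3[of "L u" "L v" "L w"]
    ultimately have "6 * f (L u * L v * L w) = 6 * (k * \<omega> (u * v * w))"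
      using that *[of u v] *[of v w] *[of u w] pow[of u 3] pow[of v 3] pow[of w 3] L_in
      by (simp add: algebra_simps)
    then show ?thesis by simp
  qed
  define z where "z = L x * L y - L (x * y)"
  have z: "z \<in> \<mm>'" using x y L_in by (simp add: z_def)
  have "f (z * w) = 0" if "w \<in> \<mm>'" for w
  proof -
    obtain v where v: "v \<in> \<mm>" "w = L v" using \<open>w \<in> \<mm>'\<close> L_surj by blast
    have "f (z * w) = f (L x * L y * L v) - f (L (x * y) * L v)"
      using x y v L_in by (simp add: z_def left_diff_distrib F.form_diff)
    then show ?thesis using x y v by (simp add: two three)
  qed
  then have "z \<in> Ann \<mm>'" using z by (intro F.form_nondegenerate)
  \<comment> \<open>Degree 1 at \<open>x * y\<close>, together with \<open>two\<close>, removes the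
    annihilator component that nondegeneracy leaves.\<close>
  moreover have "f z = 0"
    using x y L_in two[OF x y] pow[of "x * y" 1] by (simp add: z_def F.form_diff)
  ultimately have "z = 0" using F.Ann_form[of z] by simp
  then show ?thesis by (simp add: z_def)
qed

lemma affine_map_mult_hom:
  assumes L: "linear_between scale \<mm> scale' \<mm>' L" and L_bij: "bij_betw L \<mm> \<mm>'" and c: "c \<in> \<mm>'"
    and S: "\<And>y. y \<in> \<mm> \<Longrightarrow> A.defining_fun y = 0 \<Longrightarrow> B.defining_fun (L y + c) = 0"
    and x: "x \<in> \<mm>" and y: "y \<in> \<mm>"
  shows "L (x * y) = L x * L y"
proof -
  note L_in [simp] = linear_between_in[OF L] and L_add = linear_between_add[OF L]
    and L_scale = linear_between_scale[OF L]
  have L_surj: "L ` \<mm> = \<mm>'" using L_bij by (simp add: bij_betw_def)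
  then obtain d where d: "d \<in> \<mm>" "a' = L d" using B.a_in_m by blast
  have "d \<in> Ann \<mm>"
  proof (rule A.Ann_if_no_translate[OF d(1)])
    fix z assume z: "z \<in> \<mm>" "A.defining_fun z = 0"
    \<comment> \<open>A shift by \<open>a'\<close> changes P' by 2, so \<open>z\<close> and
      \<open>z + d\<close> cannot both lie on the first hypersurface.\<close>
    have "B.defining_fun (L z + c + scale' 1 a') = 2"
      using z c B.defining_fun_add_a[of "L z + c" 1] S[OF z] by simp
    moreover have "L z + c + scale' 1 a' = L (z + d) + c"
      using z d by (simp add: L_add)
    ultimately have "B.defining_fun (L (z + d) + c) = 2" by metis
    then show "A.defining_fun (z + d) \<noteq> 0" using S[of "z + d"] z d by auto
  qed
  then have "d = scale (\<omega> d) a" by (rule A.Ann_form)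
  then have "a' = scale' (\<omega> d) (L a)" using d L_scale by (metis A.a_in_m)
  moreover have "\<omega> d \<noteq> 0" using B.form_a calculation by auto
  ultimately have La: "L a = scale' (1 / \<omega> d) a'" by simp
  define k where "k = 1 / \<omega> d"
  have hom: "B.defining_fun (L z + c) = k * A.defining_fun z" if z: "z \<in> \<mm>" for z
  proof -
    \<comment> \<open>Moving \<open>z\<close> along \<open>a\<close> to a zero of P makes P' vanish
      at the image; along this line both functions are affine, with slopes in ratio
      \<open>k\<close>.\<close>
    define t where "t = - A.defining_fun z / 2"
    have "A.defining_fun (z + scale t a) = 0"
      using A.defining_fun_add_a[OF z, of t] by (simp add: t_def)
    then have "0 = B.defining_fun (L (z + scale t a) + c)" using z by (simp add: S)
    also have "L (z + scale t a) + c = L z + c + scale' (t * k) a'"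
      using z by (simp add: L_add L_scale La k_def)
    also have "B.defining_fun \<dots> = B.defining_fun (L z + c) + 2 * (t * k)"
      using z c by (intro B.defining_fun_add_a) simp
    finally show ?thesis by (simp add: t_def)
  qed
  have c0: "B.defining_fun c = 0"
    using hom[of 0] linear_between_zero[OF L] by simp
  \<comment> \<open>Since P'(c) = 0, the value P'(L z + c) is exactly f (exp (2 L z) - 1).\<close>
  define f where "f z = \<omega>' (B.expc 2 c * z)" for z
  have f: "linear_between scale' \<mm>' (*) UNIV f"
    unfolding linear_between_def f_def
    by (auto simp: distrib_left B.form_add B.mult_scale B.form_scale)
  have "B.expc 2 c * a' = a'"
    using B.mult_a[OF B.expc_minus_1_in_m[OF c, of 2]] by (simp add: algebra_simps)
  then have fa: "f a' = 1" by (simp add: f_def)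
  have "f (B.expc 2 (L z) - 1) = k * A.defining_fun z" if "z \<in> \<mm>" for z
    using hom[OF that] B.defining_fun_add[OF c, of "L z"] that c0
    by (simp add: f_def add.commute)
  then show ?thesis by (rule mult_hom[OF L L_surj f fa _ x y])
qed

lemma algebra_iso_affine:
  assumes lin: "Vector_Spaces.linear scale scale' \<phi>" and bij: "bij \<phi>"
    and mult: "\<And>x y. \<phi> (x * y) = \<phi> x * \<phi> y" and one: "\<phi> 1 = 1"
  shows "affinely_equivalent scale \<mm> {y \<in> \<mm>. A.defining_fun y = 0}
    scale' \<mm>' {y \<in> \<mm>'. B.defining_fun y = 0}"
proof -
  interpret lin: Vector_Spaces.linear scale scale' \<phi> by (rule lin)
  have inj: "\<phi> x = \<phi> y \<longleftrightarrow> x = y" for x y using bij by (meson bij_is_inj injD)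
  \<comment> \<open>The maximal ideals are the sets of nonunits, so preserving units identifies
    them.\<close>
  have "\<phi> x dvd 1 \<longleftrightarrow> x dvd 1" for x
  proof
    assume "\<phi> x dvd 1"
    then obtain w where "1 = \<phi> x * w" by (auto simp: dvd_def)
    moreover obtain v where "w = \<phi> v" using bij by (metis bij_pointE)
    ultimately have "\<phi> 1 = \<phi> (x * v)" by (simp add: mult one)
    then have "1 = x * v" by (simp only: inj)
    then show "x dvd 1" by (rule dvdI)
  next
    assume "x dvd 1"
    then show "\<phi> x dvd 1" by (metis dvd_def mult one)
  qed
  then have m: "\<phi> x \<in> \<mm>' \<longleftrightarrow> x \<in> \<mm>" for x by (simp add: A.mem_m_iff B.mem_m_iff)
  have power: "\<phi> (x ^ n) = \<phi> x ^ n" for x n by (induction n) (simp_all add: mult one)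
  \<comment> \<open>Thus the sums defining the two exponentials run over the same exponents.\<close>
  have "\<phi> x ^ n = 0 \<longleftrightarrow> x ^ n = 0" for x n
    using inj[of "x ^ n" 0] by (simp add: power)
  then have exp: "\<phi> (A.expc 2 y) = B.expc 2 (\<phi> y)" for y
    by (simp add: nil_eval_def lin.sum lin.scale power)
  have fl: "linear_between scale \<mm> (*) UNIV (\<omega>' \<circ> \<phi>)"
    unfolding linear_between_def by (auto simp: lin.add lin.scale B.form_add B.form_scale m)
  have "\<phi> a \<in> Ann \<mm>'"
  proof -
    have "\<phi> a * v = 0" if v: "v \<in> \<mm>'" for v
    proof -
      obtain u where u: "v = \<phi> u" using bij by (metis bij_pointE)
      then have "u * a = 0" using v m by (intro A.mult_a) simp
      then have "\<phi> (a * u) = 0" by (simp add: mult.commute)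
      then show ?thesis by (simp add: mult u)
    qed
    then show ?thesis by (simp add: Ann_def m)
  qed
  then have "\<phi> a = scale' (\<omega>' (\<phi> a)) a'" by (rule B.Ann_form)
  moreover have "a \<noteq> 0" using A.form_a A.form_0 by (metis zero_neq_one)
  ultimately have "(\<omega>' \<circ> \<phi>) a \<noteq> 0" using inj[of a 0] by auto
  then obtain b where b: "b \<in> \<mm>"
    "\<And>y. y \<in> \<mm> \<Longrightarrow> (\<omega>' \<circ> \<phi>) (A.expc 2 y - 1) = 0 \<longleftrightarrow> A.defining_fun (y + b) = 0"
    using A.zero_set_translate[OF fl] by blast
  have iff: "B.defining_fun (\<phi> y) = 0 \<longleftrightarrow> A.defining_fun (y + b) = 0" if "y \<in> \<mm>" for y
    using b(2)[OF that] by (simp add: B.defining_fun_def lin.diff exp one)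
  \<comment> \<open>By \<open>iff\<close> at \<open>y - b\<close>, the shift by \<open>- b\<close>
    cancels the translation of the zero set.\<close>
  let ?A = "\<lambda>y. \<phi> y + \<phi> (- b)"
  have "affine_between scale \<mm> scale' \<mm>' ?A"
    unfolding affine_between_def linear_between_def
    by (intro exI[of _ \<phi>] exI[of _ "\<phi> (- b)"]) (auto simp: m lin.add lin.scale b(1))
  moreover have surj: "\<exists>y\<in>\<mm>. w = ?A y" if "w \<in> \<mm>'" for w
  proof -
    obtain v where v: "w = \<phi> v" using bij by (metis bij_pointE)
    then show ?thesis using that m b(1) by (intro bexI[of _ "v + b"]) (auto simp: lin.add lin.neg)
  qed
  moreover have "bij_betw ?A \<mm> \<mm>'"
    unfolding bij_betw_def inj_on_def using surj b(1)
    by (auto simp: inj m)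
  moreover have "?A y \<in> \<mm>' \<and> (B.defining_fun (?A y) = 0 \<longleftrightarrow> A.defining_fun y = 0)" if "y \<in> \<mm>" for y
    using iff[of "y - b"] that b(1) m[of "y - b"] by (simp add: lin.neg lin.diff)
  then have "?A ` {y \<in> \<mm>. A.defining_fun y = 0} = {y \<in> \<mm>'. B.defining_fun y = 0}"
    using surj by (fastforce simp: image_iff)
  ultimately show ?thesis unfolding affinely_equivalent_def by blast
qed

end

text \<open>Each algebra is the direct sum of the scalars and its maximal ideal, so \<open>L\<close>
  extends by the identity on scalars.\<close>

lemma nonunital_iso_extends:
  assumes "gorenstein_algebra scale \<mm>" and "gorenstein_algebra scale' \<mm>'"
    and iso: "nonunital_algebra_iso scale \<mm> scale' \<mm>' L"
  shows "algebras_isomorphic scale scale'"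
proof -
  interpret A: gorenstein_algebra scale \<mm> by fact
  interpret B: gorenstein_algebra scale' \<mm>' by fact
  have L: "linear_between scale \<mm> scale' \<mm>' L" and L_bij: "bij_betw L \<mm> \<mm>'"
    and L_mult: "\<And>x y. x \<in> \<mm> \<Longrightarrow> y \<in> \<mm> \<Longrightarrow> L (x * y) = L x * L y"
    using iso by (auto simp: nonunital_algebra_iso_def)
  note L_in [simp] = linear_between_in[OF L] and L_add = linear_between_add[OF L]
    and L_scale = linear_between_scale[OF L]
  have "\<exists>c. x - scale c 1 \<in> \<mm>" for x by (rule A.residue_scalar) blast
  then obtain \<rho> where \<rho>: "\<And>x. x - scale (\<rho> x) 1 \<in> \<mm>" by metis
  define \<phi> where "\<phi> x = scale' (\<rho> x) 1 + L (x - scale (\<rho> x) 1)" for x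
  \<comment> \<open>The only scalar in \<open>\<mm>\<close> is 0, so the chosen
    \<open>\<rho>\<close> is forced and the decomposition is unique.\<close>
  have \<phi>: "\<phi> (scale c 1 + u) = scale' c 1 + L u" if u: "u \<in> \<mm>" for c u
  proof -
    have "scale (c - \<rho> (scale c 1 + u)) 1 \<in> \<mm>"
      using A.m_closed(3)[OF \<rho>[of "scale c 1 + u"] u] by (simp add: A.scale_left_diff_distrib)
    then have "\<rho> (scale c 1 + u) = c" by (simp add: A.scale_one_in_m_iff)
    then show ?thesis by (simp add: \<phi>_def)
  qed
  have dec: "\<exists>c u. u \<in> \<mm> \<and> x = scale c 1 + u" for x
    using \<rho>[of x] by (intro exI[of _ "\<rho> x"] exI[of _ "x - scale (\<rho> x) 1"]) simp
  have dec': "\<exists>c u. u \<in> \<mm> \<and> x = scale' c 1 + L u" for x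
  proof -
    obtain c where c: "x - scale' c 1 \<in> \<mm>'" using B.residue_scalar .
    then obtain u where u: "u \<in> \<mm>" "x - scale' c 1 = L u"
      using L_bij by (auto simp: bij_betw_def image_iff)
    then show ?thesis by (intro exI[of _ c] exI[of _ u]) (simp add: algebra_simps flip: u(2))
  qed
  have add: "\<phi> (x + y) = \<phi> x + \<phi> y" for x y
  proof -
    obtain c u d v where *: "u \<in> \<mm>" "x = scale c 1 + u" "v \<in> \<mm>" "y = scale d 1 + v"
      using dec by metis
    have e: "x + y = scale (c + d) 1 + (u + v)" using * by (simp add: A.scale_left_distrib)
    show ?thesis unfolding e using * by (simp add: \<phi> L_add B.scale_left_distrib)
  qed
  have scale: "\<phi> (scale e x) = scale' e (\<phi> x)" for e x
  proof -
    obtain c u where *: "u \<in> \<mm>" "x = scale c 1 + u" using dec by metis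
    have e: "scale e x = scale (e * c) 1 + scale e u" using * by (simp add: A.scale_right_distrib)
    show ?thesis unfolding e using * by (simp add: \<phi> L_scale B.scale_right_distrib)
  qed
  have mult: "\<phi> (x * y) = \<phi> x * \<phi> y" for x y
  proof -
    obtain c u d v where *: "u \<in> \<mm>" "x = scale c 1 + u" "v \<in> \<mm>" "y = scale d 1 + v"
      using dec by metis
    have e: "x * y = scale (c * d) 1 + (scale c v + scale d u + u * v)"
      using * by (simp add: algebra_simps A.mult_scale flip: A.scale_mult)
    have "\<phi> x = scale' c 1 + L u" "\<phi> y = scale' d 1 + L v" using * by (simp_all add: \<phi>)
    then have e': "\<phi> x * \<phi> y = scale' (c * d) 1 + (scale' c (L v) + scale' d (L u) + L u * L v)"
      by (simp add: algebra_simps B.mult_scale flip: B.scale_mult)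
    show ?thesis unfolding e e' using * by (simp add: \<phi> L_scale L_add L_mult)
  qed
  have "inj \<phi>"
  proof (rule injI)
    fix x y assume eq: "\<phi> x = \<phi> y"
    obtain c u d v where *: "u \<in> \<mm>" "x = scale c 1 + u" "v \<in> \<mm>" "y = scale d 1 + v"
      using dec by metis
    have "scale' c 1 + L u = scale' d 1 + L v" using eq * by (simp add: \<phi>)
    then have e: "scale' (c - d) 1 = L v - L u"
      by (simp add: B.scale_left_diff_distrib algebra_simps)
    then have "scale' (c - d) 1 \<in> \<mm>'" using * by simp
    then have "c = d" by (simp add: B.scale_one_in_m_iff)
    with e * L_bij show "x = y" by (simp add: bij_betw_def inj_on_def)
  qed
  moreover have "surj \<phi>"
    unfolding surj_def using dec' \<phi> by metis
  ultimately have "bij \<phi>" by (simp add: bij_def)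
  moreover have "\<phi> 1 = 1" using \<phi>[of 0 1] linear_between_zero[OF L] by simp
  moreover have "Vector_Spaces.linear scale scale' \<phi>"
    using add scale by (simp add: Vector_Spaces.linear_iff A.vector_space_axioms B.vector_space_axioms)
  ultimately show ?thesis unfolding algebras_isomorphic_def using mult by blast
qed

unbundle no fps_syntax

theorem proposition2p1:
  fixes scale :: "'f::field_char_0 \<Rightarrow> 'a::comm_ring_1 \<Rightarrow> 'a"
    and scale' :: "'f \<Rightarrow> 'b::comm_ring_1 \<Rightarrow> 'b"
    and \<mm> :: "'a set" and \<mm>' :: "'b set"
    and \<pi> :: "'a \<Rightarrow> 'a" and \<pi>' :: "'b \<Rightarrow> 'b"
  assumes "gorenstein_algebra scale \<mm>"
    and "gorenstein_algebra scale' \<mm>'"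
    and "admissible_projection scale \<mm> \<pi>"
    and "admissible_projection scale' \<mm>' \<pi>'"
  shows "(algebras_isomorphic scale scale' \<longleftrightarrow>
            affinely_equivalent scale \<mm> (hypersurface scale \<mm> \<pi>)
                                scale' \<mm>' (hypersurface scale' \<mm>' \<pi>'))
       \<and> (\<forall>\<A>. affine_between scale \<mm> scale' \<mm>' \<A>
              \<longrightarrow> bij_betw \<A> \<mm> \<mm>'
              \<longrightarrow> \<A> ` hypersurface scale \<mm> \<pi> = hypersurface scale' \<mm>' \<pi>'
              \<longrightarrow> nonunital_algebra_iso scale \<mm> scale' \<mm>' (linear_part \<A>))"
proof -
  obtain \<omega> a where A: "gorenstein_form scale \<mm> \<omega> a"
    and hA: "hypersurface scale \<mm> \<pi> = {y \<in> \<mm>. gorenstein_form.defining_fun scale \<omega> y = 0}"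
    using gorenstein_algebra.admissible_projection_form[OF assms(1,3)] .
  obtain \<omega>' a' where B: "gorenstein_form scale' \<mm>' \<omega>' a'"
    and hB: "hypersurface scale' \<mm>' \<pi>' = {y \<in> \<mm>'. gorenstein_form.defining_fun scale' \<omega>' y = 0}"
    using gorenstein_algebra.admissible_projection_form[OF assms(2,4)] .
  interpret gorenstein_form_pair scale \<mm> \<omega> a scale' \<mm>' \<omega>' a'
    unfolding gorenstein_form_pair_def using A B by blast
  have iso: "nonunital_algebra_iso scale \<mm> scale' \<mm>' (linear_part \<A>)"
    if aff: "affine_between scale \<mm> scale' \<mm>' \<A>" and bij: "bij_betw \<A> \<mm> \<mm>'"
      and im: "\<A> ` hypersurface scale \<mm> \<pi> = hypersurface scale' \<mm>' \<pi>'" for \<A>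
  proof -
    obtain L c where L: "linear_between scale \<mm> scale' \<mm>' L" and c: "c \<in> \<mm>'"
      and \<A>: "\<And>x. x \<in> \<mm> \<Longrightarrow> \<A> x = L x + c"
      using aff unfolding affine_between_def by blast
    \<comment> \<open>The constant \<open>c\<close> is the value of \<open>\<A>\<close> at 0.
      Agreement is claimed on \<open>\<mm>\<close> only, since \<open>\<A>\<close> is constrained
      only there.\<close>
    have lp: "linear_part \<A> x = L x" if "x \<in> \<mm>" for x
      using that linear_between_zero[OF L] by (simp add: linear_part_def \<A>)
    have "inj_on L \<mm>" using bij by (auto simp: bij_betw_def inj_on_def \<A>)
    moreover have "L ` \<mm> = \<mm>'"
    proof
      show "L ` \<mm> \<subseteq> \<mm>'" using linear_between_in[OF L] by blast
      show "\<mm>' \<subseteq> L ` \<mm>"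
      proof
        fix w assume "w \<in> \<mm>'"
        \<comment> \<open>A preimage of \<open>w + c\<close> under \<open>\<A>\<close> is a preimage
          of \<open>w\<close> under \<open>L\<close>.\<close>
        then have "w + c \<in> \<A> ` \<mm>" using bij c by (simp add: bij_betw_def)
        then show "w \<in> L ` \<mm>" by (auto simp: \<A>)
      qed
    qed
    ultimately have L_bij: "bij_betw L \<mm> \<mm>'" by (simp add: bij_betw_def)
    have S: "B.defining_fun (L y + c) = 0" if "y \<in> \<mm>" "A.defining_fun y = 0" for y
    proof -
      have "\<A> y \<in> hypersurface scale' \<mm>' \<pi>'" using that im hA by blast
      then show ?thesis using that by (simp add: hB \<A>)
    qed
    have "nonunital_algebra_iso scale \<mm> scale' \<mm>' L"
      unfolding nonunital_algebra_iso_def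
      using L L_bij affine_map_mult_hom[OF L L_bij c S] by blast
    moreover have "bij_betw (linear_part \<A>) \<mm> \<mm>' \<longleftrightarrow> bij_betw L \<mm> \<mm>'"
      by (rule bij_betw_cong) (rule lp)
    ultimately show ?thesis
      unfolding nonunital_algebra_iso_def linear_between_def by (auto simp: lp)
  qed
  have "affinely_equivalent scale \<mm> (hypersurface scale \<mm> \<pi>) scale' \<mm>' (hypersurface scale' \<mm>' \<pi>')"
    if "algebras_isomorphic scale scale'"
    using that algebra_iso_affine unfolding algebras_isomorphic_def hA hB by blast
  moreover have "algebras_isomorphic scale scale'"
    if "affinely_equivalent scale \<mm> (hypersurface scale \<mm> \<pi>) scale' \<mm>' (hypersurface scale' \<mm>' \<pi>')"
    using that iso nonunital_iso_extends[OF assms(1,2)] unfolding affinely_equivalent_def by blast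
  ultimately show ?thesis using iso by blast
qed

end
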